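(* Let $n$ be a positive integer, $s$ a nonnegative integer, $r$ a nonnegative integer, and $0<q<1$. Then \[ \int_{[0,1]^n}\prod_{i=1}^nx_i^r(qx_i;q)_s\prod_{1\le i<j\le n}(1-q^{s+1}x_ix_j)\prod_{1\le i<j\le n}|x_j-x_i|^2\,d_qx = n!\,q^{(r+1)\binom n2+2\binom n3}\prod_{k=1}^{n-1}[k]_q!\prod_{k=1}^n[s+2k-2]_q!\,\frac{\prod_{1\le i<j\le n}[2n+2r+s+i+j-2]_q}{\prod_{i=1}^{2n+s-1}\prod_{j=1}^n[r+i+j-1]_q}, \] \[ \int_{[0,1]^n}\prod_{i=1}^nx_i^r(qx_i;q)_s(1+q^{(s+1)/2}x_i)\prod_{1\le i<j\le n}(1-q^{s+1}x_ix_j)\prod_{1\le i<j\le n}|x_j-x_i|^2\,d_qx = n!\,q^{(r+1)\binom n2+2\binom n3}\prod_{k=1}^{n-1}[k]_q!\prod_{k=1}^n[s+2k-2]_q!\prod_{k=1}^n(1+q^{s/2+k-1/2})\,\frac{\prod_{i=1}^n[n+r+s/2+i-1/2]_q\prod_{1\le i<j\le n}[2n+2r+s+i+j-1]_q}{\prod_{i=1}^{2n+s}\prod_{j=1}^n[r+i+j-1]_q}, \] \[ \int_{[0,1]^n}\prod_{i=1}^nx_i^r(qx_i;q)_s(1-q^{(s+1)/2}x_i)\prod_{1\le i<j\le n}(1-q^{s+1}x_ix_j)\prod_{1\le i<j\le n}|x_j-x_i|^2\,d_qx = n!\,q^{(r+1)\binom n2+2\binom n3}\prod_{k=1}^{n-1}[k]_q!\prod_{k=1}^n[s+2k-2]_q!\prod_{k=1}^n[s/2+k-1/2]_q\,\frac{\prod_{i=1}^n(1+q^{n+r+s/2+i-1/2})\prod_{1\le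 i<j\le n}[2n+2r+s+i+j-1]_q}{\prod_{i=1}^{2n+s}\prod_{j=1}^n[r+i+j-1]_q}, \] \[ \int_{[0,1]^n}\prod_{i=1}^nx_i^r(qx_i;q)_s\prod_{1\le i\le j\le n}(1-q^{s+1}x_ix_j)\prod_{1\le i<j\le n}|x_j-x_i|^2\,d_qx = n!\,q^{(r+1)\binom n2+2\binom n3}\prod_{k=1}^{n-1}[k]_q!\prod_{k=1}^n[s+2k-1]_q!\,\frac{\prod_{1\le i\le j\le n}[2n+2r+s+i+j]_q}{\prod_{i=1}^{2n+s+1}\prod_{j=1}^n[r+i+j-1]_q}. \]
   Context: For a real number $a$, $[a]_q=(1-q^a)/(1-q)$; for an integer $i\ge0$, $[i]_q!=[1]_q\cdots[i]_q$ (with $[0]_q!=1$). $(qx;q)_s=\prod_{i=1}^s(1-q^ix)$. The Jackson integral is $\int_{[0,1]^n} f\,d_qx=(1-q)^n\sum_{k_1,\dots,k_n\ge0} f(q^{k_1},\dots,q^{k_n})\,q^{k_1+\cdots+k_n}$. *)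

theory Defs
  imports "HOL-Analysis.Analysis"
begin

definition q_bracket :: "real \<Rightarrow> real \<Rightarrow> real" where
  "q_bracket q a = (1 - q powr a) / (1 - q)"

definition q_fact :: "real \<Rightarrow> nat \<Rightarrow> real" where
  "q_fact q m = (\<Prod>i=1..m. q_bracket q (real i))"

text \<open>The shifted factorial \<open>(qx; q)\<^sub>s\<close>; the first factor is \<open>1 - q x\<close>, not \<open>1 - x\<close>.\<close>

definition qx_poch :: "real \<Rightarrow> real \<Rightarrow> nat \<Rightarrow> real" where
  "qx_poch q x s = (\<Prod>i=1..s. 1 - q ^ i * x)"

text \<open>
  The Jackson integral over \<open>[0,1]\<^sup>n\<close>. Points of \<open>[0,1]\<^sup>n\<close> are functions
  restricted to the index set \<open>{1..n}\<close>, and the multiple series is an unordered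
  (hence absolutely convergent) sum, with value \<open>0\<close> in the non-summable case.
\<close>

definition jackson_integral :: "real \<Rightarrow> nat \<Rightarrow> ((nat \<Rightarrow> real) \<Rightarrow> real) \<Rightarrow> real" where
  "jackson_integral q n f =
     (1 - q) ^ n *
     (\<Sum>\<^sub>\<infinity>k \<in> {1..n} \<rightarrow>\<^sub>E (UNIV :: nat set).
        f (\<lambda>i\<in>{1..n}. q ^ k i) * q ^ (\<Sum>i=1..n. k i))"

end

theory Submission
  imports Defs "Jordan_Normal_Form.Determinant"
begin

text \<open>
  The integrand is a type A Vandermonde product times a type D Vandermonde product in
  \<open>q\<^bsup>(s+1)/2\<^esup> x\<^sub>i\<close>, so by Andreief's identity the integral is \<open>n!\<close> times a determinant of moments.
  Write the type D product as the determinant of the functions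
  \<open>x\<^bsup>n-1-j\<^esup> \<Prod>\<^sub>l\<^sub><\<^sub>j (1 - q\<^bsup>s+1+l\<^esup> x) (q\<^sup>l - x)\<close>. Their extra factors extend \<open>(qx; q)\<^sub>s\<close> at both ends,
  and they vanish at \<open>x = q\<^sup>k\<close> for \<open>k < j\<close>; after shifting \<open>k\<close> by \<open>j\<close> each moment is a
  \<open>q\<close>-beta sum. Up to row and column factors, the resulting matrix of \<open>q\<close>-factorial ratios
  is again a type D alternant, now in the variables \<open>q\<^sup>i\<close>.
\<close>

section \<open>Determinants\<close>

text \<open>Passing between Newton bases with different nodes is unitriangular. In the induction the
  new factor is written as \<open>(x - t k) + (t k - c j)\<close>: the first part moves the
  \<open>k\<close>-th basis polynomial to the next one, the second only rescales it.\<close>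

lemma newton_basis_change:
  fixes c t :: "nat \<Rightarrow> 'a::comm_ring_1"
  shows "\<exists>u. u j = 1 \<and> (\<forall>x. (\<Prod>l<j. x - c l) = (\<Sum>k\<le>j. u k * (\<Prod>l<k. x - t l)))"
proof (induction j)
  case 0
  show ?case by (rule exI[of _ "\<lambda>_. 1"]) simp
next
  case (Suc j)
  then obtain u where u: "u j = 1"
    and e: "\<And>x. (\<Prod>l<j. x - c l) = (\<Sum>k\<le>j. u k * (\<Prod>l<k. x - t l))" by blast
  define v where "v k = (if k = 0 then 0 else u (k - 1)) + (if k \<le> j then u k * (t k - c j) else 0)" for k
  have "(\<Prod>l<Suc j. x - c l) = (\<Sum>k\<le>Suc j. v k * (\<Prod>l<k. x - t l))" for x
  proof -
    have "(\<Prod>l<Suc j. x - c l) = (\<Sum>k\<le>j. u k * (\<Prod>l<k. x - t l) * ((x - t k) + (t k - c j)))"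
      by (simp add: e sum_distrib_right)
    also have "\<dots> = (\<Sum>k\<le>j. u k * (\<Prod>l<Suc k. x - t l)) + (\<Sum>k\<le>j. u k * (t k - c j) * (\<Prod>l<k. x - t l))"
      by (simp add: algebra_simps flip: sum.distrib)
    also have "(\<Sum>k\<le>j. u k * (\<Prod>l<Suc k. x - t l))
        = (\<Sum>k\<le>Suc j. (if k = 0 then 0 else u (k - 1)) * (\<Prod>l<k. x - t l))"
      by (subst sum.atMost_Suc_shift) simp
    also have "(\<Sum>k\<le>j. u k * (t k - c j) * (\<Prod>l<k. x - t l))
        = (\<Sum>k\<le>Suc j. (if k \<le> j then u k * (t k - c j) else 0) * (\<Prod>l<k. x - t l))"
      by simp
    finally show ?thesis by (simp only: v_def sum.distrib distrib_right)
  qed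
  moreover have "v (Suc j) = 1" by (simp add: v_def u)
  ultimately show ?case by blast
qed

text \<open>Since the base change has determinant 1, the nodes \<open>c\<close> may be replaced by
  the evaluation points \<open>t\<close> themselves. The matrix becomes lower triangular, because
  for \<open>j > i\<close> the entry contains the factor \<open>t i - t i\<close>.\<close>

lemma det_newton:
  fixes c t :: "nat \<Rightarrow> 'a::comm_ring_1"
  shows "det (mat n n (\<lambda>(i, j). \<Prod>l<j. t i - c l)) = (\<Prod>j<n. \<Prod>i<j. t j - t i)"
proof -
  obtain u where u1: "\<And>j. u j j = 1"
    and u: "\<And>j x. (\<Prod>l<j. x - c l) = (\<Sum>k\<le>j. u j k * (\<Prod>l<k. x - t l))"
    using newton_basis_change[of _ c t] by metis
  define L where "L = mat n n (\<lambda>(i, j). \<Prod>l<j. t i - t l)"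
  define U where "U = mat n n (\<lambda>(k, j). if k \<le> j then u j k else 0)"
  have [simp]: "L \<in> carrier_mat n n" "U \<in> carrier_mat n n" by (auto simp: L_def U_def)
  have "mat n n (\<lambda>(i, j). \<Prod>l<j. t i - c l) = L * U"
  proof (rule eq_matI)
    fix i j assume "i < dim_row (L * U)" "j < dim_col (L * U)"
    then have ij: "i < n" "j < n" by (auto simp: L_def U_def)
    have "(L * U) $$ (i, j) = (\<Sum>k<n. (\<Prod>l<k. t i - t l) * (if k \<le> j then u j k else 0))"
      using ij by (simp add: L_def U_def scalar_prod_def atLeast0LessThan)
    also have "\<dots> = (\<Sum>k\<le>j. u j k * (\<Prod>l<k. t i - t l))"
      using ij by (intro sum.mono_neutral_cong_right) auto
    finally show "mat n n (\<lambda>(i, j). \<Prod>l<j. t i - c l) $$ (i, j) = (L * U) $$ (i, j)"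
      using ij by (simp add: u)
  qed (auto simp: L_def U_def)
  then have "det (mat n n (\<lambda>(i, j). \<Prod>l<j. t i - c l)) = det L * det U"
    by (simp add: det_mult[of _ n])
  also have "det L = (\<Prod>j<n. \<Prod>i<j. t j - t i)"
    by (subst det_lower_triangular[of n])
      (auto simp: L_def prod_list_diag_prod atLeast0LessThan intro!: prod_zero)
  also have "det U = 1"
    by (subst det_upper_triangular[of _ n])
      (auto simp: U_def prod_list_diag_prod u1)
  finally show ?thesis by simp
qed

lemma det_scale_rows_cols:
  fixes f :: "nat \<Rightarrow> nat \<Rightarrow> 'a::comm_ring_1"
  shows "det (mat n n (\<lambda>(i, j). a i * b j * f i j))
    = (\<Prod>i<n. a i) * (\<Prod>j<n. b j) * det (mat n n (\<lambda>(i, j). f i j))"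
proof -
  have "(\<Prod>i=0..<n. mat n n (\<lambda>(i, j). a i * b j * f i j) $$ (i, p i))
      = (\<Prod>i<n. a i) * (\<Prod>j<n. b j) * (\<Prod>i=0..<n. mat n n (\<lambda>(i, j). f i j) $$ (i, p i))"
    if p: "p permutes {0..<n}" for p
  proof -
    have lt: "p i < n" if "i < n" for i
      using permutes_in_image[OF p, of i] that by auto
    have "(\<Prod>i=0..<n. b (p i)) = (\<Prod>j<n. b j)"
      using prod.permute[OF p, of b] by (simp add: atLeast0LessThan o_def)
    moreover have "(\<Prod>i=0..<n. mat n n (\<lambda>(i, j). a i * b j * f i j) $$ (i, p i))
        = (\<Prod>i=0..<n. a i * b (p i) * f i (p i))"
      "(\<Prod>i=0..<n. mat n n (\<lambda>(i, j). f i j) $$ (i, p i)) = (\<Prod>i=0..<n. f i (p i))"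
      by (rule prod.cong; simp add: lt)+
    ultimately show ?thesis
      by (simp add: prod.distrib atLeast0LessThan)
  qed
  then show ?thesis
    unfolding det_def'[OF mat_carrier] sum_distrib_left
    by (intro sum.cong) (auto simp: ac_simps)
qed

text \<open>Rows and columns are permuted by the same reversal, so its sign enters squared.\<close>

lemma det_reverse_rows_cols:
  fixes f :: "nat \<Rightarrow> nat \<Rightarrow> 'a::comm_ring_1"
  shows "det (mat n n (\<lambda>(i, j). f (n - 1 - i) (n - 1 - j))) = det (mat n n (\<lambda>(i, j). f i j))"
proof -
  define p where "p i = (if i < n then n - 1 - i else i)" for i
  have p: "p permutes {0..<n}"
    by (rule bij_imp_permutes) (auto simp: p_def intro!: bij_betwI[of _ _ _ p])
  let ?R = "\<lambda>M::'a mat. mat n n (\<lambda>(i, j). M $$ (p i, j))"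
  have lt: "p i < n" if "i < n" for i using that by (simp add: p_def)
  have R: "det (?R M) = signof p * det M" if "M \<in> carrier_mat n n" for M
    using that by (rule det_permute_rows[OF _ p])
  let ?M = "mat n n (\<lambda>(i, j). f i j)"
  have "mat n n (\<lambda>(i, j). f (n - 1 - i) (n - 1 - j)) = transpose_mat (?R (transpose_mat (?R ?M)))"
    by (rule eq_matI) (auto simp: lt, auto simp: p_def)
  then have "det (mat n n (\<lambda>(i, j). f (n - 1 - i) (n - 1 - j))) = signof p * (signof p * det ?M)"
    by (simp add: det_transpose[of _ n] R)
  then show ?thesis by (simp add: sign_def)
qed

text \<open>After dividing row \<open>i\<close> by \<open>X\<^sub>i\<^bsup>n-1\<^esup>\<close> this is a Newton determinant in \<open>X\<^sub>i\<^sup>-\<^sup>1 + b X\<^sub>i\<close>.\<close>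

lemma det_type_D:
  fixes X v w :: "nat \<Rightarrow> 'a::field"
  assumes X: "\<And>i. i < n \<Longrightarrow> X i \<noteq> 0"
  shows "det (mat n n (\<lambda>(i, j). X i ^ (n - 1 - j) * (\<Prod>l<j. v l * (1 + b * X i ^ 2 - w l * X i))))
    = (\<Prod>j<n. \<Prod>l<j. v l) * (\<Prod>j<n. \<Prod>i<j. (X i - X j) * (1 - b * X i * X j))"
proof -
  define t where "t i = (1 + b * X i ^ 2) / X i" for i
  have "mat n n (\<lambda>(i, j). X i ^ (n - 1 - j) * (\<Prod>l<j. v l * (1 + b * X i ^ 2 - w l * X i)))
      = mat n n (\<lambda>(i, j). X i ^ (n - 1) * (\<Prod>l<j. v l) * (\<Prod>l<j. t i - w l))"
  proof (rule eq_matI, goal_cases)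
    case (1 i j)
    then have ij: "i < n" "j < n" by auto
    have "v l * (1 + b * X i ^ 2 - w l * X i) = X i * (v l * (t i - w l))" for l
      using X[OF ij(1)] by (simp add: t_def field_simps)
    then have "(\<Prod>l<j. v l * (1 + b * X i ^ 2 - w l * X i)) = X i ^ j * ((\<Prod>l<j. v l) * (\<Prod>l<j. t i - w l))"
      by (simp only: prod.distrib prod_constant card_lessThan)
    moreover have "X i ^ (n - 1) = X i ^ (n - 1 - j) * X i ^ j"
      using ij by (simp flip: power_add)
    ultimately show ?case using ij by simp
  qed auto
  then have "det (mat n n (\<lambda>(i, j). X i ^ (n - 1 - j) * (\<Prod>l<j. v l * (1 + b * X i ^ 2 - w l * X i))))
      = (\<Prod>i<n. X i ^ (n - 1)) * (\<Prod>j<n. \<Prod>l<j. v l) * (\<Prod>j<n. \<Prod>i<j. t j - t i)"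
    by (simp only: det_scale_rows_cols det_newton)
  \<comment> \<open>Each index lies in \<open>m - 1\<close> pairs, so the row factors can be
    distributed over the pairs, where \<open>X i * X j\<close> clears the denominators of
    \<open>t j - t i\<close>.\<close>
  also have "(\<Prod>i<m. X i ^ (m - 1)) = (\<Prod>j<m. \<Prod>i<j. X i * X j)" for m
  proof (induction m)
    case (Suc m)
    have "(\<Prod>i<m. X i ^ m) = (\<Prod>i<m. X i ^ (m - 1) * X i)"
      by (intro prod.cong refl, subst power_minus_mult) auto
    then show ?case using Suc by (simp add: prod.distrib)
  qed simp
  also have "(\<Prod>j<n. \<Prod>i<j. X i * X j) * (\<Prod>j<n. \<Prod>l<j. v l) * (\<Prod>j<n. \<Prod>i<j. t j - t i)
      = (\<Prod>j<n. \<Prod>l<j. v l) * (\<Prod>j<n. \<Prod>i<j. X i * X j * (t j - t i))"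
    by (simp add: prod.distrib)
  also have "(\<Prod>j<n. \<Prod>i<j. X i * X j * (t j - t i)) = (\<Prod>j<n. \<Prod>i<j. (X i - X j) * (1 - b * X i * X j))"
  proof (intro prod.cong refl)
    fix i j assume "j \<in> {..<n}" "i \<in> {..<j}"
    then have "X i \<noteq> 0" "X j \<noteq> 0" using X by auto
    then show "X i * X j * (t j - t i) = (X i - X j) * (1 - b * X i * X j)"
      by (simp add: t_def field_simps power2_eq_square)
  qed
  finally show ?thesis .
qed

section \<open>Andreief's identity for unordered sums\<close>

text \<open>For real values unordered summability is absolute summability, so the statement for
  absolutely summable families carries over.\<close>

lemma summable_on_prod_PiE:
  fixes f :: "'a \<Rightarrow> 'b::countable \<Rightarrow> real"
  assumes "finite A" and "\<And>x. x \<in> A \<Longrightarrow> f x summable_on UNIV"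
  shows "(\<lambda>g. \<Prod>x\<in>A. f x (g x)) summable_on (A \<rightarrow>\<^sub>E UNIV)"
proof -
  have "Infinite_Set_Sum.abs_summable_on (\<lambda>g. \<Prod>x\<in>A. f x (g x)) (A \<rightarrow>\<^sub>E UNIV)"
  proof (rule abs_summable_on_prod_PiE)
    show "Infinite_Set_Sum.abs_summable_on (f x) UNIV" if "x \<in> A" for x
      using assms(2)[OF that]
      by (simp only: summable_on_iff_abs_summable_on_real[of "f x"] abs_summable_equivalent)
  qed (use assms in auto)
  then show ?thesis
    by (simp only: summable_on_iff_abs_summable_on_real[symmetric] flip: abs_summable_equivalent)
qed

lemma has_sum_prod_PiE:
  fixes f :: "'a \<Rightarrow> 'b::countable \<Rightarrow> real"
  assumes "finite A" and "\<And>x. x \<in> A \<Longrightarrow> (f x has_sum S x) UNIV"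
  shows "((\<lambda>g. \<Prod>x\<in>A. f x (g x)) has_sum (\<Prod>x\<in>A. S x)) (A \<rightarrow>\<^sub>E UNIV)"
proof -
  have sm: "f x summable_on UNIV" if "x \<in> A" for x
    using assms(2)[OF that] by (rule has_sum_imp_summable)
  have "(\<lambda>g. \<Prod>x\<in>A. f x (g x)) summable_on (A \<rightarrow>\<^sub>E UNIV)"
    by (intro summable_on_prod_PiE assms(1) sm)
  moreover from this have "infsum (\<lambda>g. \<Prod>x\<in>A. f x (g x)) (A \<rightarrow>\<^sub>E UNIV) = (\<Prod>x\<in>A. infsum (f x) UNIV)"
    by (intro infsum_prod_PiE assms(1) sm)
  moreover have "(\<Prod>x\<in>A. infsum (f x) UNIV) = (\<Prod>x\<in>A. S x)"
    using assms(2) by (intro prod.cong refl infsumI)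
  ultimately show ?thesis by (simp add: has_sum_iff)
qed

lemma has_sum_finite_sum:
  fixes f :: "'a \<Rightarrow> 'b \<Rightarrow> 'c::topological_comm_monoid_add"
  assumes "\<And>i. i \<in> I \<Longrightarrow> (f i has_sum S i) A"
  shows "((\<lambda>x. \<Sum>i\<in>I. f i x) has_sum (\<Sum>i\<in>I. S i)) A"
  using assms by (induction I rule: infinite_finite_induct) (auto intro!: has_sum_add)

text \<open>The Leibniz expansion, with an index shift because matrix rows start at 0 while the
  coordinates of a point are indexed by \<open>{1..n}\<close>.\<close>

lemma det_mat_prod_Suc:
  fixes f :: "nat \<Rightarrow> 'b \<Rightarrow> 'a::comm_ring_1"
  shows "det (mat n n (\<lambda>(i, j). f j (x (Suc i))))
    = (\<Sum>p | p permutes {0..<n}. signof p * (\<Prod>i=1..n. f (p (i - 1)) (x i)))"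
proof -
  have "(\<Prod>i=0..<n. mat n n (\<lambda>(i, j). f j (x (Suc i))) $$ (i, p i)) = (\<Prod>i=1..n. f (p (i - 1)) (x i))"
    if p: "p permutes {0..<n}" for p
    by (rule prod.reindex_bij_witness[of _ "\<lambda>i. i - 1" Suc])
      (use permutes_in_image[OF p] in \<open>auto simp: less_eq_Suc_le\<close>)
  then show ?thesis
    by (subst det_def'[of _ n]) (auto intro!: sum.cong)
qed

text \<open>Both determinants are expanded by Leibniz, and each product over coordinates is summed
  factor by factor. For a fixed permutation \<open>p\<close> the sum over \<open>t\<close> is the
  determinant of \<open>S\<close> with rows permuted by \<open>p\<close>, and the remaining
  \<open>signof p\<close> cancels that sign. Each of the \<open>fact n\<close> choices of
  \<open>p\<close> thus contributes the same value.\<close>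

lemma andreief_identity:
  fixes \<phi> \<psi> :: "nat \<Rightarrow> 'b::countable \<Rightarrow> real"
  assumes S: "\<And>i j. i < n \<Longrightarrow> j < n \<Longrightarrow> ((\<lambda>y. \<phi> i y * \<psi> j y) has_sum S i j) UNIV"
  shows "((\<lambda>x. det (mat n n (\<lambda>(i, j). \<phi> j (x (Suc i)))) * det (mat n n (\<lambda>(i, j). \<psi> j (x (Suc i)))))
    has_sum (fact n * det (mat n n (\<lambda>(i, j). S i j)))) ({1..n} \<rightarrow>\<^sub>E UNIV)"
proof -
  let ?P = "{p. p permutes {0..<n}}"
  let ?S = "mat n n (\<lambda>(i, j). S i j)"
  have inner: "(\<Sum>t\<in>?P. signof p * signof t * (\<Prod>i=1..n. S (p (i - 1)) (t (i - 1)))) = det ?S"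
    if p: "p \<in> ?P" for p
  proof -
    have lt: "p i < n" if "i < n" for i using permutes_in_image[of p "{0..<n}" i] that p by auto
    have "(\<Sum>t\<in>?P. signof t * (\<Prod>i=1..n. S (p (i - 1)) (t (i - 1))))
        = det (mat n n (\<lambda>(i, j). S (p i) j))"
      using det_mat_prod_Suc[of n "\<lambda>j i. S (p (i - 1)) j" id] by simp
    also have "mat n n (\<lambda>(i, j). S (p i) j) = mat n n (\<lambda>(i, j). ?S $$ (p i, j))"
      by (rule cong_mat) (auto simp: lt)
    also have "det \<dots> = signof p * det ?S"
      using p by (intro det_permute_rows) auto
    finally have "signof p * (\<Sum>t\<in>?P. signof t * (\<Prod>i=1..n. S (p (i - 1)) (t (i - 1))))
        = signof p * (signof p * det ?S)" by simp
    also have "\<dots> = det ?S" by (simp add: sign_def)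
    finally show ?thesis by (simp only: sum_distrib_left mult.assoc)
  qed
  have "((\<lambda>x. \<Sum>p\<in>?P. \<Sum>t\<in>?P. signof p * signof t * (\<Prod>i=1..n. \<phi> (p (i - 1)) (x i) * \<psi> (t (i - 1)) (x i)))
     has_sum (\<Sum>p\<in>?P. \<Sum>t\<in>?P. signof p * signof t * (\<Prod>i=1..n. S (p (i - 1)) (t (i - 1))))) ({1..n} \<rightarrow>\<^sub>E UNIV)"
  proof (intro has_sum_finite_sum has_sum_cmult_right has_sum_prod_PiE S)
    show "p (i - 1) < n" if "p \<in> ?P" "i \<in> {1..n}" for p i
      using permutes_in_image[of p "{0..<n}" "i - 1"] that by auto
    then show "p (i - 1) < n" if "p \<in> ?P" "i \<in> {1..n}" for p i
      using that by blast
  qed auto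
  also have "(\<Sum>p\<in>?P. \<Sum>t\<in>?P. signof p * signof t * (\<Prod>i=1..n. S (p (i - 1)) (t (i - 1)))) = (\<Sum>p\<in>?P. det ?S)"
    by (intro sum.cong refl inner)
  also have "\<dots> = fact n * det ?S"
    by (simp add: card_permutations)
  also have "(\<lambda>x. \<Sum>p\<in>?P. \<Sum>t\<in>?P. signof p * signof t * (\<Prod>i=1..n. \<phi> (p (i - 1)) (x i) * \<psi> (t (i - 1)) (x i)))
     = (\<lambda>x. det (mat n n (\<lambda>(i, j). \<phi> j (x (Suc i)))) * det (mat n n (\<lambda>(i, j). \<psi> j (x (Suc i)))))"
    unfolding det_mat_prod_Suc sum_product prod.distrib
    by (intro ext sum.cong refl) (simp only: ac_simps)
  finally show ?thesis .
qed

section \<open>The q-beta sum and its variants\<close>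

lemma q_bracket_of_nat: "0 < q \<Longrightarrow> q_bracket q (real m) = (1 - q ^ m) / (1 - q)"
  by (simp add: q_bracket_def powr_realpow)

lemma q_fact_Suc: "q_fact q (Suc m) = q_fact q m * q_bracket q (real (Suc m))"
  by (simp add: q_fact_def)

lemma q_fact_0: "q_fact q 0 = 1"
  by (simp add: q_fact_def)

lemma q_bracket_pos:
  assumes "0 < q" "q < 1" "0 < a"
  shows "0 < q_bracket q a"
  using assms powr_less_mono'[of q 0 a] by (simp add: q_bracket_def)

lemma q_fact_pos: "0 < q \<Longrightarrow> q < 1 \<Longrightarrow> 0 < q_fact q m"
  unfolding q_fact_def by (intro prod_pos) (auto intro!: q_bracket_pos)

lemma q_fact_add: "q_fact q (a + m) = q_fact q a * (\<Prod>t=1..m. q_bracket q (real (a + t)))"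
  by (induction m) (simp_all add: q_fact_Suc add_ac)

lemma qx_poch_Suc: "qx_poch q x (Suc m) = qx_poch q x m * (1 - q ^ Suc m * x)"
  by (simp add: qx_poch_def)

lemma qx_poch_add: "qx_poch q x (a + b) = qx_poch q x a * qx_poch q (q ^ a * x) b"
  by (induction b) (simp_all add: qx_poch_Suc power_add ac_simps, simp add: qx_poch_def)

lemma has_sum_diff_real:
  fixes f g :: "'a \<Rightarrow> real"
  assumes "(f has_sum a) A" "(g has_sum b) A"
  shows "((\<lambda>x. f x - g x) has_sum (a - b)) A"
  using has_sum_add[OF assms(1) has_sum_cmult_right[OF assms(2), of "-1"]] by simp

text \<open>Puts two beta values over a common denominator when the second has extra factors
  \<open>u\<close> above and \<open>b\<close> below. Each variant of the beta sum then reduces to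
  factoring \<open>b + c * u\<close>.\<close>

lemma combine_fractions:
  fixes R b :: real
  assumes "R > 0" "b > 0"
  shows "P * M / R / z + c * (P * u * M / (R * b) / z) = M * (b + c * u) * P / (R * b) / z"
  using assms by (simp add: divide_simps) (simp add: algebra_simps)

text \<open>This is the Jackson integral of \<open>x ^ p * qx_poch q x m\<close> without its
  prefactor \<open>1 - q\<close>; the weight \<open>q ^ k\<close> accounts for the exponent
  \<open>p + 1\<close>. The last factor of \<open>qx_poch\<close> splits the sum into those for
  \<open>p\<close> and \<open>p + 1\<close>, hence the induction with \<open>p\<close> arbitrary;
  the base case is a geometric series.\<close>

lemma q_beta_sum:
  assumes q: "0 < q" "q < 1"
  shows "((\<lambda>k. (q ^ k) ^ (p + 1) * qx_poch q (q ^ k) m) has_sum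
    (q_fact q p * q_fact q m / q_fact q (p + m + 1) / (1 - q))) UNIV"
proof (induction m arbitrary: p)
  case 0
  have lt: "q ^ (p + 1) < 1" using q by (simp add: power_less_one_iff del: power_Suc)
  have "((\<lambda>k. (q ^ (p + 1)) ^ k) has_sum (1 / (1 - q ^ (p + 1)))) UNIV"
    using geometric_sums[of "q ^ (p + 1)"] lt q
    by (intro norm_summable_imp_has_sum) (auto simp: power_abs)
  moreover have "q_fact q p * q_fact q 0 / q_fact q (p + 0 + 1) / (1 - q) = 1 / (1 - q ^ (p + 1))"
    using q q_fact_pos[of q p] by (simp add: q_fact_Suc q_fact_0 q_bracket_of_nat del: of_nat_Suc)
  moreover have "(q ^ k) ^ (p + 1) * qx_poch q (q ^ k) 0 = (q ^ (p + 1)) ^ k" for k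
    using power_mult[of q k "p + 1"] power_mult[of q "p + 1" k]
    by (simp add: qx_poch_def mult.commute)
  ultimately show ?case by simp
next
  case (Suc m)
  have "((\<lambda>k. (q ^ k) ^ (p + 1) * qx_poch q (q ^ k) m
          - q ^ Suc m * ((q ^ k) ^ (Suc p + 1) * qx_poch q (q ^ k) m)) has_sum
     (q_fact q p * q_fact q m / q_fact q (p + m + 1) / (1 - q)
       - q ^ Suc m * (q_fact q (Suc p) * q_fact q m / q_fact q (Suc p + m + 1) / (1 - q)))) UNIV"
    by (intro has_sum_diff_real has_sum_cmult_right Suc)
  also have "(\<lambda>k. (q ^ k) ^ (p + 1) * qx_poch q (q ^ k) m
          - q ^ Suc m * ((q ^ k) ^ (Suc p + 1) * qx_poch q (q ^ k) m))
      = (\<lambda>k. (q ^ k) ^ (p + 1) * qx_poch q (q ^ k) (Suc m))"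
    by (simp add: qx_poch_Suc algebra_simps)
  also have "q_fact q p * q_fact q m / q_fact q (p + m + 1) / (1 - q)
       - q ^ Suc m * (q_fact q (Suc p) * q_fact q m / q_fact q (Suc p + m + 1) / (1 - q))
      = q_fact q p * q_fact q (Suc m) / q_fact q (p + Suc m + 1) / (1 - q)"
  proof -
    define R where "R = q_fact q (p + m + 1)"
    have R: "R > 0" using q_fact_pos q by (simp add: R_def)
    have e: "q_fact q (Suc p + m + 1) = R * q_bracket q (real (Suc (p + m + 1)))"
      "q_fact q (p + Suc m + 1) = R * q_bracket q (real (Suc (p + m + 1)))"
      using q_fact_Suc[of q "p + m + 1"] by (simp_all add: R_def)
    have b: "q_bracket q (real (Suc (p + m + 1))) > 0" using q by (intro q_bracket_pos) auto
    have "q_bracket q (real (Suc (p + m + 1))) - q ^ Suc m * q_bracket q (real (Suc p)) = q_bracket q (real (Suc m))"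
      using q unfolding q_bracket_of_nat[OF q(1)] by (simp add: field_simps power_add)
    then show ?thesis
      using combine_fractions[OF R b, of "q_fact q p" "q_fact q m" "1 - q" "- (q ^ Suc m)" "q_bracket q (real (Suc p))"]
      unfolding e q_fact_Suc[of q p] q_fact_Suc[of q m] R_def[symmetric]
      by (simp add: ac_simps del: of_nat_Suc of_nat_add power_Suc)
  qed
  finally show ?case .
qed

text \<open>The two beta sums combine to the numerator \<open>(1 - U * c ^ 2) + c * (1 - U)\<close>
  with \<open>U = q ^ (p + 1)\<close>. It factors as \<open>(1 + c) * (1 - c * U)\<close>; the
  hypothesis on \<open>c\<close> is what produces \<open>c ^ 2\<close> in the first term.\<close>

lemma q_beta_sum_linear:
  assumes q: "0 < q" "q < 1" and c: "c ^ 2 = q ^ (m + 1)"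
  shows "((\<lambda>k. (q ^ k) ^ (p + 1) * qx_poch q (q ^ k) m * (1 + c * q ^ k)) has_sum
    (q_fact q m * (1 + c) * ((1 - c * q ^ (p + 1)) / (1 - q)) * q_fact q p / q_fact q (p + m + 2) / (1 - q))) UNIV"
proof -
  let ?b = "q_bracket q (real (Suc (p + m + 1)))"
  have "((\<lambda>k. (q ^ k) ^ (p + 1) * qx_poch q (q ^ k) m + c * ((q ^ k) ^ (Suc p + 1) * qx_poch q (q ^ k) m)) has_sum
    (q_fact q p * q_fact q m / q_fact q (p + m + 1) / (1 - q)
      + c * (q_fact q (Suc p) * q_fact q m / q_fact q (Suc p + m + 1) / (1 - q)))) UNIV"
    by (intro has_sum_add has_sum_cmult_right q_beta_sum q)
  also have "(\<lambda>k. (q ^ k) ^ (p + 1) * qx_poch q (q ^ k) m + c * ((q ^ k) ^ (Suc p + 1) * qx_poch q (q ^ k) m))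
     = (\<lambda>k. (q ^ k) ^ (p + 1) * qx_poch q (q ^ k) m * (1 + c * q ^ k))"
    by (simp add: algebra_simps)
  also have "q_fact q p * q_fact q m / q_fact q (p + m + 1) / (1 - q)
      + c * (q_fact q (Suc p) * q_fact q m / q_fact q (Suc p + m + 1) / (1 - q))
    = q_fact q m * (1 + c) * ((1 - c * q ^ (p + 1)) / (1 - q)) * q_fact q p / q_fact q (p + m + 2) / (1 - q)"
  proof -
    define R where "R = q_fact q (p + m + 1)"
    have R: "R > 0" using q_fact_pos q by (simp add: R_def)
    have e: "q_fact q (Suc p + m + 1) = R * ?b" "q_fact q (p + m + 2) = R * ?b"
      using q_fact_Suc[of q "p + m + 1"] by (simp_all add: R_def)
    have b: "?b > 0" using q by (intro q_bracket_pos) auto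
    have "q ^ Suc (p + m + 1) = q ^ Suc p * c ^ 2" unfolding c by (simp add: power_add)
    then have "?b + c * q_bracket q (real (Suc p))
        = ((1 - q ^ Suc p * c ^ 2) + c * (1 - q ^ Suc p)) / (1 - q)"
      unfolding q_bracket_of_nat[OF q(1)] by (simp only: add_divide_distrib times_divide_eq_right)
    also have "(1 - q ^ Suc p * c ^ 2) + c * (1 - q ^ Suc p) = (1 + c) * (1 - c * q ^ (p + 1))"
      by (simp add: algebra_simps power2_eq_square)
    finally have "?b + c * q_bracket q (real (Suc p)) = (1 + c) * ((1 - c * q ^ (p + 1)) / (1 - q))"
      by simp
    then show ?thesis
      unfolding e q_fact_Suc[of q p] R_def[symmetric] combine_fractions[OF R b]
      by (simp only: mult.assoc)
  qed
  finally show ?thesis .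
qed

lemma q_beta_sum_quadratic:
  assumes q: "0 < q" "q < 1"
  shows "((\<lambda>k. (q ^ k) ^ (p + 1) * qx_poch q (q ^ k) m * (1 - q ^ (m + 1) * (q ^ k) ^ 2)) has_sum
    (q_fact q (m + 1) * q_bracket q (real (2 * p + m + 4)) * q_fact q p / q_fact q (p + m + 3) / (1 - q))) UNIV"
proof -
  let ?b = "q_bracket q (real (Suc (p + m + 1)))" and ?d = "q_bracket q (real (Suc (p + m + 2)))"
  let ?u = "q_bracket q (real (Suc p))" and ?v = "q_bracket q (real (Suc (Suc p)))"
  have "((\<lambda>k. (q ^ k) ^ (p + 1) * qx_poch q (q ^ k) m
      - q ^ (m + 1) * ((q ^ k) ^ (Suc (Suc p) + 1) * qx_poch q (q ^ k) m)) has_sum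
    (q_fact q p * q_fact q m / q_fact q (p + m + 1) / (1 - q)
      - q ^ (m + 1) * (q_fact q (Suc (Suc p)) * q_fact q m / q_fact q (Suc (Suc p) + m + 1) / (1 - q)))) UNIV"
    by (intro has_sum_diff_real has_sum_cmult_right q_beta_sum q)
  also have "(\<lambda>k. (q ^ k) ^ (p + 1) * qx_poch q (q ^ k) m
      - q ^ (m + 1) * ((q ^ k) ^ (Suc (Suc p) + 1) * qx_poch q (q ^ k) m))
     = (\<lambda>k. (q ^ k) ^ (p + 1) * qx_poch q (q ^ k) m * (1 - q ^ (m + 1) * (q ^ k) ^ 2))"
    by (simp add: algebra_simps power2_eq_square)
  also have "q_fact q p * q_fact q m / q_fact q (p + m + 1) / (1 - q)
      - q ^ (m + 1) * (q_fact q (Suc (Suc p)) * q_fact q m / q_fact q (Suc (Suc p) + m + 1) / (1 - q))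
    = q_fact q (m + 1) * q_bracket q (real (2 * p + m + 4)) * q_fact q p / q_fact q (p + m + 3) / (1 - q)"
  proof -
    define R where "R = q_fact q (p + m + 1)"
    have R: "R > 0" using q_fact_pos q by (simp add: R_def)
    have "q_fact q (p + m + 3) = R * ?b * ?d"
      using q_fact_Suc[of q "p + m + 1"] q_fact_Suc[of q "p + m + 2"]
      by (simp add: R_def numeral_eq_Suc)
    then have e: "q_fact q (Suc (Suc p) + m + 1) = R * ?b * ?d" "q_fact q (p + m + 3) = R * ?b * ?d"
      by (simp_all add: numeral_eq_Suc)
    have b: "?b > 0" "?d > 0" using q by (intro q_bracket_pos; auto)+
    have pw: "q ^ Suc (p + m + 1) = q ^ Suc p * q ^ Suc m" "q ^ Suc (p + m + 2) = q * q ^ Suc p * q ^ Suc m"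
       "q ^ (2 * p + m + 4) = q * q ^ Suc p * q ^ Suc p * q ^ Suc m" "q ^ Suc (Suc p) = q * q ^ Suc p"
      by (simp_all add: power_add mult_2 numeral_eq_Suc)
    \<comment> \<open>Here \<open>U = q ^ (p + 1)\<close> and \<open>V = q ^ (m + 1)\<close>; the
      mixed terms in \<open>U * V\<close> cancel, which makes the difference factor.\<close>
    have id: "(1 - U * V) / z * ((1 - q * U * V) / z) - V * ((1 - U) / z * ((1 - q * U) / z))
        = (1 - V) / z * ((1 - q * U * U * V) / z)" for U V z :: real
      by (cases "z = 0") (simp_all add: field_simps)
    have "?b * ?d - q ^ (m + 1) * (?u * ?v) = q_bracket q (real (Suc m)) * q_bracket q (real (2 * p + m + 4))"
      unfolding q_bracket_of_nat[OF q(1)] pw by (simp only: id Suc_eq_plus1)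
    then show ?thesis
      using combine_fractions[OF R mult_pos_pos[OF b], of "q_fact q p" "q_fact q m" "1 - q" "- (q ^ (m + 1))" "?u * ?v"]
        q_fact_Suc[of q m]
      unfolding e q_fact_Suc[of q "Suc p"] q_fact_Suc[of q p] R_def[symmetric]
      by (simp add: mult.assoc del: of_nat_Suc of_nat_add)
  qed
  finally show ?thesis .
qed

section \<open>The moment determinant\<close>

lemma prod_pairs_Suc:
  fixes g :: "nat \<Rightarrow> nat \<Rightarrow> 'a::comm_monoid_mult"
  shows "(\<Prod>j<n. \<Prod>i<j. g (Suc i) (Suc j)) = (\<Prod>i=1..n. \<Prod>j\<in>{i<..n}. g i j)"
proof -
  have "(\<Prod>j<n. \<Prod>i<j. g (Suc i) (Suc j)) = (\<Prod>(j, i)\<in>(SIGMA j:{..<n}. {..<j}). g (Suc i) (Suc j))"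
    by (rule prod.Sigma) auto
  also have "\<dots> = (\<Prod>(i, j)\<in>(SIGMA i:{1..n}. {i<..n}). g i j)"
    by (rule prod.reindex_bij_witness[of _ "\<lambda>(i, j). (j - 1, i - 1)" "\<lambda>(j, i). (Suc i, Suc j)"]) auto
  also have "\<dots> = (\<Prod>i=1..n. \<Prod>j\<in>{i<..n}. g i j)"
    by (rule prod.Sigma[symmetric]) auto
  finally show ?thesis .
qed

lemma prod_lessThan_Suc_shift:
  fixes g :: "nat \<Rightarrow> 'a::comm_monoid_mult"
  shows "(\<Prod>i<n. g (Suc i)) = (\<Prod>i=1..n. g i)"
  by (rule prod.reindex_bij_witness[of _ "\<lambda>i. i - 1" Suc]) auto

text \<open>At \<open>x = q ^ (k + J)\<close> three blocks of factors
  \<open>1 - q ^ i * q ^ k\<close> join up. The factors \<open>q ^ l - x\<close> give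
  \<open>i = 1..J\<close> after extracting \<open>q ^ l\<close>, \<open>qx_poch\<close> gives the
  next \<open>s\<close> exponents, and the factors \<open>1 - q ^ (s + 1 + l) * x\<close> give the
  last \<open>J\<close>.\<close>

lemma qx_poch_shift:
  fixes q :: real
  shows "qx_poch q (q ^ (k + J)) s * (\<Prod>l<J. (1 - q ^ (s + 1 + l) * q ^ (k + J)) * (q ^ l - q ^ (k + J)))
    = (\<Prod>l<J. q ^ l) * qx_poch q (q ^ k) (s + 2 * J)"
proof -
  have "(\<Prod>l<J. q ^ l - q ^ (k + J)) = (\<Prod>l<J. q ^ l * (1 - q ^ (J - l) * q ^ k))"
  proof (rule prod.cong)
    fix l assume "l \<in> {..<J}"
    then have "k + J = l + (J - l) + k" by simp
    then have "q ^ (k + J) = q ^ l * q ^ (J - l) * q ^ k"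
      by (metis power_add)
    then show "q ^ l - q ^ (k + J) = q ^ l * (1 - q ^ (J - l) * q ^ k)"
      by (simp only: right_diff_distrib mult.assoc mult_1_right)
  qed simp
  also have "\<dots> = (\<Prod>l<J. q ^ l) * (\<Prod>l<J. 1 - q ^ (J - l) * q ^ k)"
    by (simp add: prod.distrib)
  also have "(\<Prod>l<J. 1 - q ^ (J - l) * q ^ k) = qx_poch q (q ^ k) J"
    unfolding qx_poch_def
    by (rule prod.reindex_bij_witness[of _ "\<lambda>i. J - i" "\<lambda>i. J - i"]) auto
  finally have a: "(\<Prod>l<J. q ^ l - q ^ (k + J)) = (\<Prod>l<J. q ^ l) * qx_poch q (q ^ k) J" .
  have "(\<Prod>l<J. 1 - q ^ (s + 1 + l) * q ^ (k + J)) = qx_poch q (q ^ s * q ^ (k + J)) J"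
    unfolding qx_poch_def
    by (rule prod.reindex_bij_witness[of _ "\<lambda>i. i - 1" Suc]) (auto simp: power_add)
  then have b: "qx_poch q (q ^ (k + J)) s * (\<Prod>l<J. 1 - q ^ (s + 1 + l) * q ^ (k + J)) = qx_poch q (q ^ J * q ^ k) (s + J)"
    using qx_poch_add[of q "q ^ J * q ^ k" s J] by (simp add: power_add ac_simps)
  have "s + 2 * J = J + (s + J)" by simp
  then have "qx_poch q (q ^ k) (s + 2 * J) = qx_poch q (q ^ k) J * qx_poch q (q ^ J * q ^ k) (s + J)"
    by (simp only: qx_poch_add)
  then show ?thesis
    by (simp add: prod.distrib a flip: b)
qed

lemma has_sum_shift_zero:
  fixes f :: "nat \<Rightarrow> real"
  assumes "((\<lambda>k. f (k + J)) has_sum S) UNIV" and "\<And>k. k < J \<Longrightarrow> f k = 0"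
  shows "(f has_sum S) UNIV"
proof -
  have "(f has_sum S) (range (\<lambda>k. k + J))"
    using assms(1) by (subst has_sum_reindex) (auto simp: o_def)
  moreover have "range (\<lambda>k. k + J) = {J..}"
    by (auto simp: image_iff le_iff_add add.commute)
  ultimately have "(f has_sum S) {J..}" by simp
  then show ?thesis
    by (subst has_sum_cong_neutral[of "{J..}" _ f]) (use assms(2) in auto)
qed

text \<open>Isolates the dependence on \<open>j\<close>. The exponents of the two brackets in each
  factor add up to \<open>m + 1 + N\<close>, independent of \<open>l\<close>; this is what produces
  a type D alternant.\<close>

lemma q_fact_ratio:
  assumes q: "0 < q" "q < 1" and "j \<le> N"
  shows "q_fact q (m + j) / q_fact q (N - j)
    = q_fact q m / q_fact q N * (\<Prod>l<j. q_bracket q (real (m + 1 + l)) * q_bracket q (real (N - l)))"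
  using \<open>j \<le> N\<close>
proof (induction j)
  case (Suc j)
  have "q_fact q (N - j) = q_fact q (N - Suc j) * q_bracket q (real (N - j))"
    using q_fact_Suc[of q "N - Suc j"] Suc.prems by (simp add: Suc_diff_Suc)
  moreover have "q_bracket q (real (N - j)) > 0"
    using Suc.prems q by (intro q_bracket_pos) auto
  ultimately have "q_fact q (m + Suc j) / q_fact q (N - Suc j)
     = q_fact q (m + j) / q_fact q (N - j) * (q_bracket q (real (m + 1 + j)) * q_bracket q (real (N - j)))"
    using q_fact_Suc[of q "m + j"] by (simp add: field_simps)
  then show ?case using Suc by simp
qed simp

text \<open>The first sum comes from extracting \<open>q ^ i\<close> out of
  \<open>q ^ i - q ^ j\<close>, the second from the column factors that shifting the summation index
  creates.\<close>

lemma sum_q_exponents: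
  "(\<Sum>j<n. \<Sum>i<j. i) + (\<Sum>j<n. (n - 1 - j) * (r + j + 1)) = (r + 1) * (n choose 2) + 2 * (n choose 3)"
proof -
  have c2: "(\<Sum>i<m. i) = m choose 2" for m :: nat
    by (induction m) (simp_all add: numeral_eq_Suc)
  have c3: "(\<Sum>j<m. j choose 2) = m choose 3" for m :: nat
    by (induction m) (simp_all add: numeral_eq_Suc)
  have "(\<Sum>j<n. (n - 1 - j) * (r + j + 1)) = (r + 1) * (n choose 2) + (n choose 3)"
  proof (induction n)
    case (Suc n)
    have "(\<Sum>j<Suc n. (Suc n - 1 - j) * (r + j + 1)) = (\<Sum>j<n. (n - 1 - j) * (r + j + 1) + (r + 1 + j))"
    proof -
      have "(Suc n - 1 - j) * (r + j + 1) = (n - 1 - j) * (r + j + 1) + (r + 1 + j)" if "j < n" for j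
      proof -
        have "Suc n - 1 - j = Suc (n - 1 - j)" using that by simp
        then show ?thesis by simp
      qed
      then show ?thesis by simp
    qed
    also have "\<dots> = (r + 1) * (n choose 2) + (n choose 3) + (n * (r + 1) + (n choose 2))"
      by (simp only: sum.distrib Suc c2 sum_constant card_lessThan) (simp add: algebra_simps)
    also have "\<dots> = (r + 1) * (Suc n choose 2) + (Suc n choose 3)"
      by (simp add: numeral_eq_Suc algebra_simps)
    finally show ?case .
  qed simp
  then show ?thesis by (simp add: c2 c3)
qed

section \<open>Evaluation with a general one-variable factor\<close>

text \<open>
  \<open>E\<close> is the additional one-variable factor of the integrand. The hypothesis asks that its
  \<open>q\<close>-beta sum splits into a part depending only on the column and one depending only on the row.
\<close>

lemma jackson_integral_type_D:
  fixes n s r e :: nat and q :: real and E :: "real \<Rightarrow> real" and C D :: "nat \<Rightarrow> real"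
  assumes n: "n \<ge> 1" and q: "0 < q" "q < 1"
    and moment: "\<And>i J p. i < n \<Longrightarrow> J < n \<Longrightarrow> p + J + 1 = r + i + n \<Longrightarrow>
      ((\<lambda>k. (q ^ k) ^ (p + 1) * qx_poch q (q ^ k) (s + 2 * J) * E (q ^ (k + J))) has_sum
        (C J * D i * q_fact q p / q_fact q (p + s + 2 * J + 1 + e) / (1 - q))) UNIV"
  shows "jackson_integral q n (\<lambda>x.
             (\<Prod>i=1..n. x i ^ r * qx_poch q (x i) s * E (x i))
           * (\<Prod>i=1..n. \<Prod>j\<in>{i<..n}. 1 - q ^ (s + 1) * x i * x j)
           * (\<Prod>i=1..n. \<Prod>j\<in>{i<..n}. \<bar>x j - x i\<bar> ^ 2))
         = fact n * q ^ ((r + 1) * (n choose 2) + 2 * (n choose 3)) * (\<Prod>k=1..n - 1. q_fact q k)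
           * (\<Prod>k=1..n. C (k - 1)) * (\<Prod>i=1..n. D (i - 1))
           * ((\<Prod>i=1..n. \<Prod>j\<in>{i<..n}. q_bracket q (real (2 * n + 2 * r + s + e + i + j) - 2))
              / (\<Prod>i=1..2 * n + s + e - 1. \<Prod>j=1..n. q_bracket q (real (r + i + j) - 1)))"
proof -
  \<comment> \<open>The leading factor \<open>x\<close> is the weight \<open>q ^ k\<close> of the
    Jackson integral.\<close>
  define W where "W x = x * x ^ r * qx_poch q x s * E x" for x :: real
  define V where "V j = (\<Prod>l<j. q ^ l)" for j :: nat
  \<comment> \<open>Chosen so that the quadratic in the type D determinant splits into
    \<open>1 - q ^ (s + 1 + l) * x\<close> and \<open>q ^ l - x\<close>.\<close>
  define w where "w l = 1 / q ^ l + q ^ (s + 1 + l)" for l :: nat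
  define \<phi> where "\<phi> j k = (q ^ k) ^ (n - 1 - j)" for j k :: nat
  define \<psi> where "\<psi> j k = W (q ^ k) * ((q ^ k) ^ (n - 1 - j) *
      (\<Prod>l<j. q ^ l * (1 + q ^ (s + 1) * (q ^ k) ^ 2 - w l * q ^ k)))" for j k :: nat
  \<comment> \<open>Indexed in reverse: \<open>T i j\<close> is the moment of functions number
    \<open>n - 1 - i\<close> and \<open>n - 1 - j\<close>, so that \<open>p = r + i + j\<close> and
    \<open>J = n - 1 - j\<close> in \<open>moment\<close>.\<close>
  define T where "T i j = V (n - 1 - j) * q ^ ((n - 1 - j) * (r + i + j + 1)) *
      (C (n - 1 - j) * D i * q_fact q (r + i + j) / q_fact q (r + s + e + 2 * n - 1 + i - j) / (1 - q))" for i j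
  have V0: "V j > 0" for j unfolding V_def by (intro prod_pos) (use q in auto)

  have factor: "q ^ l * (1 + q ^ (s + 1) * x ^ 2 - w l * x) = (1 - q ^ (s + 1 + l) * x) * (q ^ l - x)" for l x
    using q by (simp add: w_def field_simps power_add power2_eq_square)

  have entry: "((\<lambda>k. \<phi> i k * \<psi> j k) has_sum T (n - 1 - i) (n - 1 - j)) UNIV"
    if ij: "i < n" "j < n" for i j
  proof -
    define p where "p = r + (n - 1 - i) + (n - 1 - j)"
    define f where "f k = (q ^ k) ^ (p + 1) * E (q ^ k) * (qx_poch q (q ^ k) s *
        (\<Prod>l<j. (1 - q ^ (s + 1 + l) * q ^ k) * (q ^ l - q ^ k)))" for k
    have "\<phi> i k * \<psi> j k = f k" for k
      unfolding \<phi>_def \<psi>_def W_def f_def factor p_def by (simp add: power_add ac_simps)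
    moreover have "(f has_sum T (n - 1 - i) (n - 1 - j)) UNIV"
    \<comment> \<open>For \<open>k < j\<close> the factor with \<open>l = k\<close> vanishes, so the
      summation may start at \<open>j\<close>.\<close>
    proof (rule has_sum_shift_zero[of _ j])
      show "f k = 0" if "k < j" for k
        using that unfolding f_def by (auto intro!: bexI[of _ k])
      have "((\<lambda>k. V j * q ^ (j * (p + 1)) *
          ((q ^ k) ^ (p + 1) * qx_poch q (q ^ k) (s + 2 * j) * E (q ^ (k + j)))) has_sum
          (V j * q ^ (j * (p + 1)) * (C j * D (n - 1 - i) * q_fact q p / q_fact q (p + s + 2 * j + 1 + e) / (1 - q)))) UNIV"
        using ij by (intro has_sum_cmult_right moment) (auto simp: p_def)
      also have "V j * q ^ (j * (p + 1)) * (C j * D (n - 1 - i) * q_fact q p / q_fact q (p + s + 2 * j + 1 + e) / (1 - q))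
          = T (n - 1 - i) (n - 1 - j)"
      proof -
        have e: "n - 1 - (n - 1 - j) = j" "p + s + 2 * j + 1 + e = r + s + e + 2 * n - 1 + (n - 1 - i) - (n - 1 - j)"
          using ij by (auto simp: p_def)
        show ?thesis unfolding T_def e(1) e(2)[symmetric] p_def[symmetric] by (rule refl)
      qed
      also have "(\<lambda>k. V j * q ^ (j * (p + 1)) *
          ((q ^ k) ^ (p + 1) * qx_poch q (q ^ k) (s + 2 * j) * E (q ^ (k + j)))) = (\<lambda>k. f (k + j))"
      proof
        fix k
        have "(q ^ (k + j)) ^ (p + 1) = q ^ (j * (p + 1)) * (q ^ k) ^ (p + 1)"
          by (simp only: power_add power_mult_distrib power_mult ac_simps)
        then show "V j * q ^ (j * (p + 1)) *
          ((q ^ k) ^ (p + 1) * qx_poch q (q ^ k) (s + 2 * j) * E (q ^ (k + j))) = f (k + j)"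
          unfolding f_def qx_poch_shift V_def by (simp only: ac_simps)
      qed
      finally show "((\<lambda>k. f (k + j)) has_sum T (n - 1 - i) (n - 1 - j)) UNIV" .
    qed
    ultimately show ?thesis by simp
  qed

  \<comment> \<open>With \<open>b = 0\<close> and \<open>w = 0\<close> the type D determinant
    degenerates to a Vandermonde determinant.\<close>
  have det_\<phi>: "det (mat n n (\<lambda>(i, j). \<phi> j (k (Suc i)))) = (\<Prod>i=1..n. \<Prod>j\<in>{i<..n}. q ^ k i - q ^ k j)" for k
    using det_type_D[of n "\<lambda>i. q ^ k (Suc i)" "\<lambda>_. 1" 0 "\<lambda>_. 0"] q
      prod_pairs_Suc[of "\<lambda>i j. q ^ k i - q ^ k j" n]
    by (simp add: \<phi>_def)
  have det_\<psi>: "det (mat n n (\<lambda>(i, j). \<psi> j (k (Suc i)))) = (\<Prod>i=1..n. W (q ^ k i)) * (\<Prod>j<n. V j) *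
      (\<Prod>i=1..n. \<Prod>j\<in>{i<..n}. (q ^ k i - q ^ k j) * (1 - q ^ (s + 1) * q ^ k i * q ^ k j))" for k
  proof -
    have "det (mat n n (\<lambda>(i, j). \<psi> j (k (Suc i)))) = (\<Prod>i<n. W (q ^ k (Suc i))) *
        det (mat n n (\<lambda>(i, j). (q ^ k (Suc i)) ^ (n - 1 - j) *
          (\<Prod>l<j. q ^ l * (1 + q ^ (s + 1) * (q ^ k (Suc i)) ^ 2 - w l * q ^ k (Suc i)))))"
      using det_scale_rows_cols[of n "\<lambda>i. W (q ^ k (Suc i))" "\<lambda>_. 1"] by (simp add: \<psi>_def)
    also have "\<dots> = (\<Prod>i<n. W (q ^ k (Suc i))) * ((\<Prod>j<n. V j) * (\<Prod>j<n. \<Prod>i<j.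
        (q ^ k (Suc i) - q ^ k (Suc j)) * (1 - q ^ (s + 1) * q ^ k (Suc i) * q ^ k (Suc j))))"
      unfolding V_def by (subst det_type_D) (use q in auto)
    finally show ?thesis
      unfolding prod_lessThan_Suc_shift[of "\<lambda>i. W (q ^ k i)"]
        prod_pairs_Suc[of "\<lambda>i j. (q ^ k i - q ^ k j) * (1 - q ^ (s + 1) * q ^ k i * q ^ k j)"]
      by (simp only: mult.assoc)
  qed

  have det_T: "det (mat n n (\<lambda>(i, j). T i j)) =
      (\<Prod>i<n. D i * (q_fact q (r + i) / q_fact q (r + s + e + 2 * n - 1 + i))) *
      (\<Prod>j<n. V (n - 1 - j) * q ^ ((n - 1 - j) * (r + j + 1)) * C (n - 1 - j) / (1 - q)) *
      ((\<Prod>j<n. \<Prod>l<j. 1 / (1 - q) ^ 2) * (\<Prod>j<n. \<Prod>i<j. (q ^ i - q ^ j) * (1 - q ^ (2 * r + s + e + 2 * n) * q ^ i * q ^ j)))"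
  proof -
    let ?N = "r + s + e + 2 * n - 1"
    \<comment> \<open>The sum of the two powers of \<open>q\<close> in a bracket pair at
      \<open>i = 0\<close>; their product \<open>q ^ (2 * r + s + e + 2 * n)\<close> plays the part
      of \<open>b\<close> in \<open>det_type_D\<close>, with \<open>X i = q ^ i\<close>.\<close>
    define w' where "w' l = q ^ (r + 1 + l) + q ^ (?N - l)" for l
    have T_eq: "mat n n (\<lambda>(i, j). T i j) = mat n n (\<lambda>(i, j).
        (D i * (q_fact q (r + i) / q_fact q (?N + i))) *
        (V (n - 1 - j) * q ^ ((n - 1 - j) * (r + j + 1)) * C (n - 1 - j) / (1 - q)) *
        ((q ^ i) ^ (n - 1 - j) * (\<Prod>l<j. 1 / (1 - q) ^ 2 * (1 + q ^ (2 * r + s + e + 2 * n) * (q ^ i) ^ 2 - w' l * q ^ i))))"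
    proof (rule cong_mat, simp_all only: prod.case)
      fix i j assume ij: "i < n" "j < n"
      have "q_fact q (r + i + j) / q_fact q (?N + i - j) = q_fact q (r + i) / q_fact q (?N + i) *
          (\<Prod>l<j. q_bracket q (real (r + i + 1 + l)) * q_bracket q (real (?N + i - l)))"
        using q ij by (intro q_fact_ratio) auto
      also have "(\<Prod>l<j. q_bracket q (real (r + i + 1 + l)) * q_bracket q (real (?N + i - l)))
          = (\<Prod>l<j. 1 / (1 - q) ^ 2 * (1 + q ^ (2 * r + s + e + 2 * n) * (q ^ i) ^ 2 - w' l * q ^ i))"
      proof (rule prod.cong)
        fix l assume "l \<in> {..<j}"
        then have l: "l < n" using ij by auto
        then have ex: "?N + i - l = ?N - l + i" "2 * r + s + e + 2 * n = (r + 1 + l) + (?N - l)"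
          by auto
        have pw: "q ^ (r + i + 1 + l) = q ^ (r + 1 + l) * q ^ i" "q ^ (?N + i - l) = q ^ (?N - l) * q ^ i"
            "q ^ (2 * r + s + e + 2 * n) = q ^ (r + 1 + l) * q ^ (?N - l)"
          unfolding ex by (simp_all add: power_add)
        have "(1 - a * z) / y * ((1 - b * z) / y) = 1 / y ^ 2 * (1 + a * b * z ^ 2 - (a + b) * z)" for a b y z :: real
          by (simp add: power2_eq_square algebra_simps add_divide_distrib diff_divide_distrib)
        then show "q_bracket q (real (r + i + 1 + l)) * q_bracket q (real (?N + i - l))
           = 1 / (1 - q) ^ 2 * (1 + q ^ (2 * r + s + e + 2 * n) * (q ^ i) ^ 2 - w' l * q ^ i)"
          unfolding q_bracket_of_nat[OF q(1)] pw w'_def by simp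
      qed simp
      finally have 1: "q_fact q (r + i + j) / q_fact q (?N + i - j) = q_fact q (r + i) / q_fact q (?N + i) *
          (\<Prod>l<j. 1 / (1 - q) ^ 2 * (1 + q ^ (2 * r + s + e + 2 * n) * (q ^ i) ^ 2 - w' l * q ^ i))" .
      \<comment> \<open>The power created by the index shift supplies exactly the monomial
        \<open>X i ^ (n - 1 - j)\<close> of the alternant.\<close>
      have 2: "q ^ ((n - 1 - j) * (r + i + j + 1)) = q ^ ((n - 1 - j) * (r + j + 1)) * (q ^ i) ^ (n - 1 - j)"
        by (simp add: algebra_simps flip: power_add power_mult)
      have "T i j = V (n - 1 - j) * q ^ ((n - 1 - j) * (r + i + j + 1)) *
           (C (n - 1 - j) * D i * (q_fact q (r + i + j) / q_fact q (?N + i - j)) / (1 - q))"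
        by (simp add: T_def)
      also have "\<dots> = D i * (q_fact q (r + i) / q_fact q (?N + i)) *
        (V (n - 1 - j) * q ^ ((n - 1 - j) * (r + j + 1)) * C (n - 1 - j) / (1 - q)) *
        ((q ^ i) ^ (n - 1 - j) * (\<Prod>l<j. 1 / (1 - q) ^ 2 * (1 + q ^ (2 * r + s + e + 2 * n) * (q ^ i) ^ 2 - w' l * q ^ i)))"
        unfolding 1 2 by (simp only: times_divide_eq_right times_divide_eq_left ac_simps)
      finally show "T i j = D i * (q_fact q (r + i) / q_fact q (?N + i)) *
        (V (n - 1 - j) * q ^ ((n - 1 - j) * (r + j + 1)) * C (n - 1 - j) / (1 - q)) *
        ((q ^ i) ^ (n - 1 - j) * (\<Prod>l<j. 1 / (1 - q) ^ 2 * (1 + q ^ (2 * r + s + e + 2 * n) * (q ^ i) ^ 2 - w' l * q ^ i)))" .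
    qed
    show ?thesis
      unfolding T_eq by (subst det_scale_rows_cols, subst det_type_D) (use q in auto)
  qed

  have "((\<lambda>k. det (mat n n (\<lambda>(i, j). \<phi> j (k (Suc i)))) * det (mat n n (\<lambda>(i, j). \<psi> j (k (Suc i))))) has_sum
      (fact n * det (mat n n (\<lambda>(i, j). T (n - 1 - i) (n - 1 - j))))) ({1..n} \<rightarrow>\<^sub>E UNIV)"
    by (rule andreief_identity) (rule entry)
  note S = this[unfolded det_reverse_rows_cols det_\<phi> det_\<psi>]
  let ?M = "2 * n + s + e - 1"
  have zn: "(1 - q) ^ n > 0" using q by simp
  have VP: "(\<Prod>j<n. V j) > 0" using V0 by (intro prod_pos) auto

  let ?f = "\<lambda>x. (\<Prod>i=1..n. x i ^ r * qx_poch q (x i) s * E (x i))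
           * (\<Prod>i=1..n. \<Prod>j\<in>{i<..n}. 1 - q ^ (s + 1) * x i * x j)
           * (\<Prod>i=1..n. \<Prod>j\<in>{i<..n}. \<bar>x j - x i\<bar> ^ 2)"
  \<comment> \<open>The squared differences provide one Vandermonde product for each determinant,
    and \<open>1 / (\<Prod>j<n. V j)\<close> removes the normalisation of the second one.\<close>
  have integrand: "?f (\<lambda>i\<in>{1..n}. q ^ k i) * q ^ (\<Sum>i=1..n. k i) = 1 / (\<Prod>j<n. V j) *
      ((\<Prod>i=1..n. \<Prod>j\<in>{i<..n}. q ^ k i - q ^ k j) * ((\<Prod>i=1..n. W (q ^ k i)) * (\<Prod>j<n. V j) *
      (\<Prod>i=1..n. \<Prod>j\<in>{i<..n}. (q ^ k i - q ^ k j) * (1 - q ^ (s + 1) * q ^ k i * q ^ k j))))" for k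
  proof -
    have f_eq: "?f (\<lambda>i\<in>{1..n}. q ^ k i) =
        (\<Prod>i=1..n. (q ^ k i) ^ r * qx_poch q (q ^ k i) s * E (q ^ k i))
           * (\<Prod>i=1..n. \<Prod>j\<in>{i<..n}. 1 - q ^ (s + 1) * q ^ k i * q ^ k j)
           * (\<Prod>i=1..n. \<Prod>j\<in>{i<..n}. (q ^ k i - q ^ k j) * (q ^ k i - q ^ k j))"
      by (intro arg_cong2[of _ _ _ _ "(*)"] prod.cong refl) (auto simp: power2_eq_square algebra_simps)
    have cancel: "1 / v * (a * (b * v * d)) = a * b * d" if "v > 0" for v a b d :: real
      using that by simp
    show ?thesis
      unfolding f_eq cancel[OF VP] by (simp only: W_def prod.distrib power_sum ac_simps)
  qed
  \<comment> \<open>Here \<open>v\<close> is the product of the \<open>V j\<close>, which also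
    occurs in \<open>det_T\<close>, and \<open>z = (1 - q) ^ n\<close> is the Jackson prefactor,
    which meets one division by \<open>1 - q\<close> per column.\<close>
  have cancel: "z * (1 / v) * N * (d / y * (v * a * c / z) * (b * F * B)) = N * (b * a) * F * c * d * (B / y)"
    if "v > 0" "z > 0" for z v N d y a c b F B :: real
    using that by simp
  have "jackson_integral q n ?f = (1 - q) ^ n * (1 / (\<Prod>j<n. V j) * (fact n * det (mat n n (\<lambda>(i, j). T i j))))"
    unfolding jackson_integral_def integrand
    by (intro arg_cong2[of _ _ _ _ "(*)"] refl infsumI has_sum_cmult_right S)
  also have "\<dots> = (1 - q) ^ n * (1 / (\<Prod>j<n. V j)) * fact n * det (mat n n (\<lambda>(i, j). T i j))"
    by simp
  also note det_T
  also have "(\<Prod>i<n. D i * (q_fact q (r + i) / q_fact q (r + s + e + 2 * n - 1 + i))) =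
      (\<Prod>i=1..n. D (i - 1)) / (\<Prod>i=1..?M. \<Prod>j=1..n. q_bracket q (real (r + i + j) - 1))"
  proof -
    have "(\<Prod>i<n. D i * (q_fact q (r + i) / q_fact q (r + s + e + 2 * n - 1 + i)))
        = (\<Prod>i<n. D (Suc i - 1) / (\<Prod>t=1..?M. q_bracket q (real (r + t + Suc i) - 1)))"
    proof (rule prod.cong)
      fix i
      \<comment> \<open>The quotient of q-factorials leaves \<open>?M\<close> brackets in the
        denominator; \<open>n \<ge> 1\<close> keeps the truncated subtraction exact.\<close>
      have "r + s + e + 2 * n - 1 + i = r + i + ?M" using n by simp
      then have "q_fact q (r + s + e + 2 * n - 1 + i)
          = q_fact q (r + i) * (\<Prod>t=1..?M. q_bracket q (real (r + i + t)))"
        by (simp only: q_fact_add)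
      then show "D i * (q_fact q (r + i) / q_fact q (r + s + e + 2 * n - 1 + i))
          = D (Suc i - 1) / (\<Prod>t=1..?M. q_bracket q (real (r + t + Suc i) - 1))"
        using q_fact_pos[OF q, of "r + i"] by (simp add: add_ac)
    qed simp
    also have "\<dots> = (\<Prod>i=1..n. D (i - 1)) / (\<Prod>j=1..n. \<Prod>i=1..?M. q_bracket q (real (r + i + j) - 1))"
      unfolding prod_lessThan_Suc_shift[of "\<lambda>i. D (i - 1) / (\<Prod>t=1..?M. q_bracket q (real (r + t + i) - 1))"]
      by (rule prod_dividef)
    also have "(\<Prod>j=1..n. \<Prod>i=1..?M. q_bracket q (real (r + i + j) - 1))
        = (\<Prod>i=1..?M. \<Prod>j=1..n. q_bracket q (real (r + i + j) - 1))"
      by (rule prod.swap)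
    finally show ?thesis .
  qed
  also have "(\<Prod>j<n. V (n - 1 - j) * q ^ ((n - 1 - j) * (r + j + 1)) * C (n - 1 - j) / (1 - q)) =
      (\<Prod>j<n. V j) * q ^ (\<Sum>j<n. (n - 1 - j) * (r + j + 1)) * (\<Prod>k=1..n. C (k - 1)) / (1 - q) ^ n"
  proof -
    have "(\<Prod>j<n. V (n - 1 - j)) = (\<Prod>j<n. V j)" "(\<Prod>j<n. C (n - 1 - j)) = (\<Prod>k=1..n. C (k - 1))"
      using prod.nat_diff_reindex[of V n] prod.nat_diff_reindex[of C n]
        prod_lessThan_Suc_shift[of "\<lambda>k. C (k - 1)" n] by simp_all
    then show ?thesis
      by (simp only: prod_dividef prod.distrib power_sum prod_constant card_lessThan)
  qed
  \<comment> \<open>Each pair has two divisions by \<open>1 - q\<close>, one for the bracket of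
    \<open>j - i\<close> and one for the bracket of the sum. The former multiply to
    \<open>q_fact q j\<close> for each \<open>j\<close>.\<close>
  also have "(\<Prod>j<n. \<Prod>l<j. 1 / (1 - q) ^ 2) *
      (\<Prod>j<n. \<Prod>i<j. (q ^ i - q ^ j) * (1 - q ^ (2 * r + s + e + 2 * n) * q ^ i * q ^ j)) =
      q ^ (\<Sum>j<n. \<Sum>i<j. i) * (\<Prod>k=1..n - 1. q_fact q k) *
      (\<Prod>i=1..n. \<Prod>j\<in>{i<..n}. q_bracket q (real (2 * n + 2 * r + s + e + i + j) - 2))"
  proof -
    have q_fact_rev: "(\<Prod>i<j. q_bracket q (real (j - i))) = q_fact q j" for j
      unfolding q_fact_def by (rule prod.reindex_bij_witness[of _ "\<lambda>i. j - i" "\<lambda>i. j - i"]) auto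
    have "(\<Prod>j<n. \<Prod>l<j. 1 / (1 - q) ^ 2) *
      (\<Prod>j<n. \<Prod>i<j. (q ^ i - q ^ j) * (1 - q ^ (2 * r + s + e + 2 * n) * q ^ i * q ^ j))
      = (\<Prod>j<n. \<Prod>i<j. q ^ i * q_bracket q (real (j - i)) *
          q_bracket q (real (2 * n + 2 * r + s + e + Suc i + Suc j) - 2))"
      unfolding prod.distrib[symmetric]
    proof (intro prod.cong refl)
      fix i j :: nat assume "i \<in> {..<j}"
      then have "q ^ j = q ^ i * q ^ (j - i)" by (simp flip: power_add)
      then have 1: "q ^ i - q ^ j = q ^ i * (1 - q ^ (j - i))" by (simp add: algebra_simps)
      have 2: "q ^ (2 * r + s + e + 2 * n) * q ^ i * q ^ j = q ^ (2 * n + 2 * r + s + e + i + j)"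
        by (simp add: ac_simps flip: power_add)
      have 3: "real (2 * n + 2 * r + s + e + Suc i + Suc j) - 2 = real (2 * n + 2 * r + s + e + i + j)"
        by simp
      show "1 / (1 - q)\<^sup>2 * ((q ^ i - q ^ j) * (1 - q ^ (2 * r + s + e + 2 * n) * q ^ i * q ^ j)) =
         q ^ i * q_bracket q (real (j - i)) * q_bracket q (real (2 * n + 2 * r + s + e + Suc i + Suc j) - 2)"
        unfolding 1 2 3 q_bracket_of_nat[OF q(1)] by (simp add: power2_eq_square)
    qed
    also have "\<dots> = (\<Prod>j<n. \<Prod>i<j. q ^ i) * (\<Prod>j<n. \<Prod>i<j. q_bracket q (real (j - i))) *
        (\<Prod>j<n. \<Prod>i<j. q_bracket q (real (2 * n + 2 * r + s + e + Suc i + Suc j) - 2))"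
      by (simp only: prod.distrib)
    also have "(\<Prod>j<n. \<Prod>i<j. q ^ i) = q ^ (\<Sum>j<n. \<Sum>i<j. i)"
      by (simp only: power_sum)
    also have "(\<Prod>j<n. \<Prod>i<j. q_bracket q (real (j - i))) = (\<Prod>j<n. q_fact q j)"
      by (simp only: q_fact_rev)
    also have "(\<Prod>j<n. q_fact q j) = (\<Prod>k=1..n - 1. q_fact q k)"
      using n by (intro prod.mono_neutral_right) (auto simp: q_fact_0 not_le)
    finally show ?thesis
      unfolding prod_pairs_Suc[of "\<lambda>i j. q_bracket q (real (2 * n + 2 * r + s + e + i + j) - 2)"] .
  qed
  also note cancel[OF VP zn]
  finally show ?thesis
    unfolding sum_q_exponents[symmetric] power_add .
qed

section \<open>Specialisation to the four integrals\<close>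

text \<open>Covers the second and third integrals through the two square roots \<open>c\<close> of
  \<open>q ^ (s + 1)\<close>. After the shift by \<open>J\<close> the linear factor has coefficient
  \<open>c * q ^ J\<close>, whose square is \<open>q ^ (s + 2 * J + 1)\<close>, as the linear beta
  sum requires. Moreover \<open>c * q ^ J * q ^ (p + 1) = c * q ^ (r + i + n)\<close> depends on the
  row only.\<close>

lemma jackson_integral_type_B:
  fixes n s r :: nat and q c :: real
  assumes n: "n \<ge> 1" and q: "0 < q" "q < 1" and c: "c ^ 2 = q ^ (s + 1)"
  shows "jackson_integral q n (\<lambda>x.
             (\<Prod>i=1..n. x i ^ r * qx_poch q (x i) s * (1 + c * x i))
           * (\<Prod>i=1..n. \<Prod>j\<in>{i<..n}. 1 - q ^ (s + 1) * x i * x j)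
           * (\<Prod>i=1..n. \<Prod>j\<in>{i<..n}. \<bar>x j - x i\<bar> ^ 2))
         = fact n * q ^ ((r + 1) * (n choose 2) + 2 * (n choose 3)) * (\<Prod>k=1..n - 1. q_fact q k)
           * (\<Prod>k=1..n. q_fact q (s + 2 * k - 2))
           * (\<Prod>k=1..n. 1 + c * q ^ (k - 1))
           * ((\<Prod>i=1..n. (1 - c * q ^ (n + r + i - 1)) / (1 - q))
              * (\<Prod>i=1..n. \<Prod>j\<in>{i<..n}. q_bracket q (real (2 * n + 2 * r + s + i + j) - 1))
              / (\<Prod>i=1..2 * n + s. \<Prod>j=1..n. q_bracket q (real (r + i + j) - 1)))"
proof -
  have "((\<lambda>k. (q ^ k) ^ (p + 1) * qx_poch q (q ^ k) (s + 2 * J) * (1 + c * q ^ (k + J))) has_sum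
        (q_fact q (s + 2 * J) * (1 + c * q ^ J) * ((1 - c * q ^ (r + i + n)) / (1 - q))
          * q_fact q p / q_fact q (p + s + 2 * J + 1 + 1) / (1 - q))) UNIV"
    if "p + J + 1 = r + i + n" for i J p
  proof -
    have "(c * q ^ J) ^ 2 = q ^ (s + 2 * J + 1)"
      by (simp only: power_mult_distrib c) (simp add: power_add mult_2 power2_eq_square)
    from q_beta_sum_linear[OF q this, of p] show ?thesis
      unfolding that[symmetric] by (simp add: power_add ac_simps)
  qed
  note jackson_integral_type_D[OF n q, where E = "\<lambda>x. 1 + c * x" and e = 1
      and C = "\<lambda>J. q_fact q (s + 2 * J) * (1 + c * q ^ J)"
      and D = "\<lambda>i. (1 - c * q ^ (r + i + n)) / (1 - q)", OF this]
  moreover have "(\<Prod>k=1..n. q_fact q (s + 2 * (k - 1)) * (1 + c * q ^ (k - 1)))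
      = (\<Prod>k=1..n. q_fact q (s + 2 * k - 2)) * (\<Prod>k=1..n. 1 + c * q ^ (k - 1))"
    unfolding prod.distrib[symmetric] by (intro prod.cong) (auto simp: diff_mult_distrib2)
  moreover have "(\<Prod>i=1..n. (1 - c * q ^ (r + (i - 1) + n)) / (1 - q)) = (\<Prod>i=1..n. (1 - c * q ^ (n + r + i - 1)) / (1 - q))"
    by (intro prod.cong) (auto simp: ac_simps)
  moreover have "real (2 * n + 2 * r + s + 1 + i + j) - 2 = real (2 * n + 2 * r + s + i + j) - 1" for i j
    by simp
  moreover have "2 * n + s + 1 - 1 = 2 * n + s" by simp
  ultimately show ?thesis by (simp only: mult.assoc times_divide_eq_right)
qed

theorem theorem5p1:
  fixes n s r :: nat and q :: real
  assumes "n \<ge> 1" and "0 < q" and "q < 1"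
  shows
     "jackson_integral q n (\<lambda>x.
             (\<Prod>i=1..n. x i ^ r * qx_poch q (x i) s)
           * (\<Prod>i=1..n. \<Prod>j\<in>{i<..n}. 1 - q ^ (s + 1) * x i * x j)
           * (\<Prod>i=1..n. \<Prod>j\<in>{i<..n}. \<bar>x j - x i\<bar> ^ 2))
         = fact n * q ^ ((r + 1) * (n choose 2) + 2 * (n choose 3)) * (\<Prod>k=1..n - 1. q_fact q k)
           * (\<Prod>k=1..n. q_fact q (s + 2 * k - 2))
           * ((\<Prod>i=1..n. \<Prod>j\<in>{i<..n}. q_bracket q (real (2 * n + 2 * r + s + i + j) - 2))
              / (\<Prod>i=1..2 * n + s - 1. \<Prod>j=1..n. q_bracket q (real (r + i + j) - 1))) \<and>
      jackson_integral q n (\<lambda>x.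
             (\<Prod>i=1..n. x i ^ r * qx_poch q (x i) s * (1 + q powr ((real s + 1) / 2) * x i))
           * (\<Prod>i=1..n. \<Prod>j\<in>{i<..n}. 1 - q ^ (s + 1) * x i * x j)
           * (\<Prod>i=1..n. \<Prod>j\<in>{i<..n}. \<bar>x j - x i\<bar> ^ 2))
         = fact n * q ^ ((r + 1) * (n choose 2) + 2 * (n choose 3)) * (\<Prod>k=1..n - 1. q_fact q k)
           * (\<Prod>k=1..n. q_fact q (s + 2 * k - 2))
           * (\<Prod>k=1..n. 1 + q powr (real s / 2 + real k - 1 / 2))
           * ((\<Prod>i=1..n. q_bracket q (real n + real r + real s / 2 + real i - 1 / 2))
              * (\<Prod>i=1..n. \<Prod>j\<in>{i<..n}. q_bracket q (real (2 * n + 2 * r + s + i + j) - 1))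
              / (\<Prod>i=1..2 * n + s. \<Prod>j=1..n. q_bracket q (real (r + i + j) - 1))) \<and>
      jackson_integral q n (\<lambda>x.
             (\<Prod>i=1..n. x i ^ r * qx_poch q (x i) s * (1 - q powr ((real s + 1) / 2) * x i))
           * (\<Prod>i=1..n. \<Prod>j\<in>{i<..n}. 1 - q ^ (s + 1) * x i * x j)
           * (\<Prod>i=1..n. \<Prod>j\<in>{i<..n}. \<bar>x j - x i\<bar> ^ 2))
         = fact n * q ^ ((r + 1) * (n choose 2) + 2 * (n choose 3)) * (\<Prod>k=1..n - 1. q_fact q k)
           * (\<Prod>k=1..n. q_fact q (s + 2 * k - 2))
           * (\<Prod>k=1..n. q_bracket q (real s / 2 + real k - 1 / 2))
           * ((\<Prod>i=1..n. 1 + q powr (real n + real r + real s / 2 + real i - 1 / 2))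
              * (\<Prod>i=1..n. \<Prod>j\<in>{i<..n}. q_bracket q (real (2 * n + 2 * r + s + i + j) - 1))
              / (\<Prod>i=1..2 * n + s. \<Prod>j=1..n. q_bracket q (real (r + i + j) - 1))) \<and>
      jackson_integral q n (\<lambda>x.
             (\<Prod>i=1..n. x i ^ r * qx_poch q (x i) s)
           * (\<Prod>i=1..n. \<Prod>j\<in>{i..n}. 1 - q ^ (s + 1) * x i * x j)
           * (\<Prod>i=1..n. \<Prod>j\<in>{i<..n}. \<bar>x j - x i\<bar> ^ 2))
         = fact n * q ^ ((r + 1) * (n choose 2) + 2 * (n choose 3)) * (\<Prod>k=1..n - 1. q_fact q k)
           * (\<Prod>k=1..n. q_fact q (s + 2 * k - 1))
           * ((\<Prod>i=1..n. \<Prod>j\<in>{i..n}. q_bracket q (real (2 * n + 2 * r + s + i + j)))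
              / (\<Prod>i=1..2 * n + s + 1. \<Prod>j=1..n. q_bracket q (real (r + i + j) - 1)))"
  (is "?I1 \<and> ?I2 \<and> ?I3 \<and> ?I4")
proof -
  note n = assms(1) and q = assms(2,3)
  have half: "(q powr ((real s + 1) / 2)) ^ 2 = q ^ (s + 1)"
  proof -
    have "(q powr ((real s + 1) / 2)) ^ 2 = q powr ((real s + 1) / 2 + (real s + 1) / 2)"
      by (simp only: powr_add power2_eq_square)
    also have "(real s + 1) / 2 + (real s + 1) / 2 = real (s + 1)" by simp
    finally show ?thesis using q by (simp only: powr_realpow)
  qed
  have halfpow: "q powr ((real s + 1) / 2) * q ^ m = q powr ((real s + 1) / 2 + real m)" for m
    using q by (simp add: powr_add powr_realpow)
  \<comment> \<open>The values \<open>a = 1\<close> and \<open>a = -1\<close> serve the second and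
    the third integral.\<close>
  have C: "(\<Prod>k=1..n. 1 + a * (q powr ((real s + 1) / 2) * q ^ (k - 1)))
      = (\<Prod>k=1..n. 1 + a * q powr (real s / 2 + real k - 1 / 2))" for a
    unfolding halfpow
    by (intro prod.cong refl arg_cong2[of _ _ _ _ "(+)"] arg_cong2[of _ _ _ _ "(*)"] arg_cong2[of _ _ _ _ "(powr)"])
      (auto simp: field_simps of_nat_diff)
  have D: "(\<Prod>i=1..n. (1 - a * (q powr ((real s + 1) / 2) * q ^ (n + r + i - 1))) / (1 - q))
      = (\<Prod>i=1..n. (1 - a * q powr (real n + real r + real s / 2 + real i - 1 / 2)) / (1 - q))" for a
    unfolding halfpow
    by (intro prod.cong refl arg_cong2[of _ _ _ _ "(/)"] arg_cong2[of _ _ _ _ "(-)"]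
          arg_cong2[of _ _ _ _ "(*)"] arg_cong2[of _ _ _ _ "(powr)"])
      (auto simp: field_simps of_nat_diff)

  have I1: ?I1
  proof -
    have "((\<lambda>k. (q ^ k) ^ (p + 1) * qx_poch q (q ^ k) (s + 2 * J) * 1) has_sum
        (q_fact q (s + 2 * J) * 1 * q_fact q p / q_fact q (p + s + 2 * J + 1 + 0) / (1 - q))) UNIV" for J p
      using q_beta_sum[OF q, of p "s + 2 * J"] by (simp add: ac_simps)
    note jackson_integral_type_D[OF n q, where E = "\<lambda>_. 1" and e = 0 and D = "\<lambda>_. 1"
        and C = "\<lambda>J. q_fact q (s + 2 * J)" and r = r, OF this]
    moreover have "(\<Prod>k=1..n. q_fact q (s + 2 * (k - 1))) = (\<Prod>k=1..n. q_fact q (s + 2 * k - 2))"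
      by (intro prod.cong) (auto simp: diff_mult_distrib2)
    ultimately show ?thesis by simp
  qed
  have I2: ?I2
    using jackson_integral_type_B[OF n q half, of r] C[of 1] D[of 1]
    by (simp only: mult_1 q_bracket_def)
  have I3: ?I3
  proof -
    let ?c = "q powr ((real s + 1) / 2)"
    have neg: "1 + - ?c * y = 1 - ?c * y" for y by simp
    \<comment> \<open>For negative \<open>c\<close> the two products exchange roles: the divisions
      by \<open>1 - q\<close> move from the row factors, now of the form
      \<open>1 + q powr _\<close>, to the column factors, which become brackets.\<close>
    have C': "(\<Prod>k=1..n. 1 - ?c * q ^ (k - 1)) / (1 - q) ^ n
        = (\<Prod>k=1..n. q_bracket q (real s / 2 + real k - 1 / 2))"
      using C[of "-1"] by (simp add: q_bracket_def prod_dividef)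
    have D': "(\<Prod>i=1..n. (1 - - ?c * q ^ (n + r + i - 1)) / (1 - q))
        = (\<Prod>i=1..n. 1 + q powr (real n + real r + real s / 2 + real i - 1 / 2)) / (1 - q) ^ n"
      using D[of "-1"] q by (simp add: prod_dividef)
    have swap: "a * b * (d / z * y / w) = a * (b / z) * (d * y / w)" for a b d z y w :: real
      by simp
    have "(- ?c) ^ 2 = q ^ (s + 1)" using half by simp
    from jackson_integral_type_B[OF n q this, of r] show ?thesis
      unfolding neg D' swap C' .
  qed
  \<comment> \<open>The diagonal factors \<open>i = j\<close> of the product are absorbed into
    \<open>E\<close>. Their beta sums contribute the row bracket of
    \<open>2 * p + (s + 2 * J) + 4\<close>, in which \<open>J\<close> cancels; it becomes the
    diagonal part of the numerator once rows are counted from 1.\<close>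
  have I4: ?I4
  proof -
    have "((\<lambda>k. (q ^ k) ^ (p + 1) * qx_poch q (q ^ k) (s + 2 * J) * (1 - q ^ (s + 1) * (q ^ (k + J)) ^ 2)) has_sum
        (q_fact q (s + 2 * J + 1) * q_bracket q (real (2 * r + 2 * n + 2 * i + s + 2))
          * q_fact q p / q_fact q (p + s + 2 * J + 1 + 2) / (1 - q))) UNIV"
      if p: "p + J + 1 = r + i + n" for i J p
    proof -
      have 1: "2 * r + 2 * n + 2 * i + s + 2 = 2 * p + (s + 2 * J) + 4" using p by simp
      have 2: "p + s + 2 * J + 1 + 2 = p + (s + 2 * J) + 3" by simp
      have 3: "q ^ (s + 1) * (q ^ (k + J)) ^ 2 = q ^ (s + 2 * J + 1) * (q ^ k) ^ 2" for k
        by (simp add: power_add mult_2 power2_eq_square)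
      show ?thesis unfolding 1 2 3 by (rule q_beta_sum_quadratic[OF q])
    qed
    note jackson_integral_type_D[OF n q, where E = "\<lambda>x. 1 - q ^ (s + 1) * x ^ 2" and e = 2
        and D = "\<lambda>i. q_bracket q (real (2 * r + 2 * n + 2 * i + s + 2))"
        and C = "\<lambda>J. q_fact q (s + 2 * J + 1)" and r = r, OF this]
    moreover have "(\<Prod>k=1..n. q_fact q (s + 2 * (k - 1) + 1)) = (\<Prod>k=1..n. q_fact q (s + 2 * k - 1))"
      by (intro prod.cong) (auto simp: diff_mult_distrib2 intro!: arg_cong[of _ _ "q_fact q"])
    moreover have split: "(\<Prod>i=1..n. \<Prod>j\<in>{i..n}. g i j) = (\<Prod>i=1..n. g i i) * (\<Prod>i=1..n. \<Prod>j\<in>{i<..n}. g i j)"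
      for g :: "nat \<Rightarrow> nat \<Rightarrow> real"
      unfolding prod.distrib[symmetric]
      by (intro prod.cong refl) (auto simp: prod.head)
    moreover have "(\<Prod>i=1..n. q_bracket q (real (2 * r + 2 * n + 2 * (i - 1) + s + 2)))
        = (\<Prod>i=1..n. q_bracket q (real (2 * n + 2 * r + s + i + i)))"
      by (intro prod.cong) (auto intro!: arg_cong[of _ _ "q_bracket q"])
    moreover have "real (2 * n + 2 * r + s + 2 + i + j) - 2 = real (2 * n + 2 * r + s + i + j)" for i j
      by simp
    moreover have "2 * n + s + 2 - 1 = 2 * n + s + 1" by simp
    ultimately show ?thesis
      by (simp only: split prod.distrib power2_eq_square mult.assoc times_divide_eq_right)
  qed
  show ?thesis using I1 I2 I3 I4 by (intro conjI)
qed

end
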